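(* Let $s \geq k \geq 3$ be integers and let $p=p(n)$ satisfy $n^{-s} \ll p \ll n^{2-s - 1/m_2(K_k)}$ (i.e. $p n^{s}\to\infty$ and $p\, n^{s-2+1/m_2(K_k)}\to 0$). Let $\mathcal{H} = \mathcal{H}_s(n,p)$. Then there is a function $\varepsilon(n)\to 0$ such that, with probability tending to $1$ as $n\to\infty$, there exists a linear $k$-conformal hypergraph $\mathcal{H}_0 \subseteq \mathcal{H}$ with at least $(1 - \varepsilon(n))e(\mathcal{H})$ hyperedges.
   Context: The maximum $2$-density of a graph $F$ is $m_2(F)=\max\{\frac{e(J)-1}{v(J)-2} : J\subseteq F,\ v(J)\geq 3\}$. The random $s$-uniform hypergraph $\mathcal{H}_s(n,p)$ has $n$ vertices and contains each $s$-element subset of vertices as a hyperedge independently with probability $p$; $e(\mathcal{H})$ is its number of hyperedges. The primal graph $G[\mathcal{H}]$ has vertex set $V(\mathcal{H})$ and edges all pairs of vertices lying together in some hyperedge of $\mathcal{H}$. A hypergraph is linear if every two distinct hyperedges share at most one vertex. A hypergraph $\mathcal{H}$ is $k$-conformal if every set of exactly $k$ vertices forming a clique in $G[\mathcal{H}]$ is contained in some hyperedge of $\mathcal{H}$. *)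

theory Defs
  imports "HOL-Probability.Probability" "HOL-Probability.Product_PMF"
begin

text \<open>A hypergraph is a pair of a vertex set and a set of hyperedges; a graph is a hypergraph all of
  whose hyperedges have exactly two elements.\<close>

type_synonym 'a hypergraph = "'a set \<times> 'a set set"

abbreviation verts :: "'a hypergraph \<Rightarrow> 'a set" where
  "verts H \<equiv> fst H"

abbreviation hyperedges :: "'a hypergraph \<Rightarrow> 'a set set" where
  "hyperedges H \<equiv> snd H"

definition wf_hypergraph :: "'a hypergraph \<Rightarrow> bool" where
  "wf_hypergraph H \<longleftrightarrow> (\<forall>e\<in>hyperedges H. e \<subseteq> verts H)"

definition subhypergraph :: "'a hypergraph \<Rightarrow> 'a hypergraph \<Rightarrow> bool" where
  "subhypergraph J H \<longleftrightarrow>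
     wf_hypergraph J \<and> verts J \<subseteq> verts H \<and> hyperedges J \<subseteq> hyperedges H"

definition complete_simple_graph :: "nat \<Rightarrow> nat hypergraph" where
  "complete_simple_graph k = ({..<k}, {e. e \<subseteq> {..<k} \<and> card e = 2})"

text \<open>Meaningful for a finite graph with at least three vertices; otherwise the maximum is not over
  a finite nonempty set.\<close>

definition max_2_density :: "'a hypergraph \<Rightarrow> real" where
  "max_2_density F =
     Max {(real (card (hyperedges J)) - 1) / (real (card (verts J)) - 2) | J.
            subhypergraph J F \<and> card (verts J) \<ge> 3}"

definition primal_graph :: "'a hypergraph \<Rightarrow> 'a hypergraph" where
  "primal_graph H =
     (verts H, {f. f \<subseteq> verts H \<and> card f = 2 \<and> (\<exists>e\<in>hyperedges H. f \<subseteq> e)})"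

definition is_clique :: "'a hypergraph \<Rightarrow> 'a set \<Rightarrow> bool" where
  "is_clique G K \<longleftrightarrow>
     K \<subseteq> verts G \<and> (\<forall>u\<in>K. \<forall>v\<in>K. u \<noteq> v \<longrightarrow> {u, v} \<in> hyperedges G)"

definition linear_hypergraph :: "'a hypergraph \<Rightarrow> bool" where
  "linear_hypergraph H \<longleftrightarrow>
     (\<forall>e\<in>hyperedges H. \<forall>f\<in>hyperedges H. e \<noteq> f \<longrightarrow> finite (e \<inter> f) \<and> card (e \<inter> f) \<le> 1)"

definition conformal :: "nat \<Rightarrow> 'a hypergraph \<Rightarrow> bool" where
  "conformal k H \<longleftrightarrow>
     (\<forall>K. finite K \<and> card K = k \<and> is_clique (primal_graph H) K
        \<longrightarrow> (\<exists>e\<in>hyperedges H. K \<subseteq> e))"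

definition random_hypergraph :: "nat \<Rightarrow> nat \<Rightarrow> real \<Rightarrow> nat hypergraph pmf" where
  "random_hypergraph s n p =
     (let S = {e. e \<subseteq> {..<n} \<and> card e = s}
      in map_pmf (\<lambda>X. ({..<n}, {e\<in>S. X e})) (Pi_pmf S False (\<lambda>_. bernoulli_pmf p)))"

end

theory Submission
  imports Defs
begin

text \<open>
  Call \<open>(K, F)\<close> a dense configuration if \<open>K\<close> is a \<open>k\<close>-set of vertices and \<open>F\<close> a set of at least two
  hyperedges, each meeting \<open>K\<close> in at least two vertices, with
  \<open>\<Sum>f\<in>F. (card (f \<inter> K) choose 2) \<ge> (k choose 2)\<close>. Both a pair of hyperedges sharing two vertices
  and a \<open>k\<close>-clique contained in no hyperedge give rise to one, so deleting one hyperedge from every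
  dense configuration leaves a linear \<open>k\<close>-conformal hypergraph.

  Since \<open>m\<^sub>2(K\<^sub>k) = (k + 1)/2\<close>, put \<open>c = 2/(k + 1)\<close> and \<open>\<delta> = p n\<^bsup>s-2+c\<^esup> \<longlonglongrightarrow> 0\<close>. To count dense
  configurations, give \<open>f\<close> the weight \<open>w(f) = (card (f \<inter> K) choose 2)\<close> and bound the indicator of
  \<open>w(F) \<ge> (k choose 2)\<close> by \<open>n\<close> to the power \<open>c (w(F) - (k choose 2))\<close>. By convexity
  \<open>c (a choose 2) \<le> a - 2 + c\<close> for \<open>2 \<le> a \<le> k\<close>, with equality at both ends, so the tilted weights
  \<open>p n\<^bsup>c w(f)\<^esup>\<close> of all \<open>f\<close> sum to \<open>O(\<delta>)\<close>; summing their products over sets \<open>F\<close> of size at least two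
  gives \<open>O(\<delta>\<^sup>2)\<close>, and the expected number of dense configurations is
  \<open>O(n\<^sup>k n\<^bsup>-(k-2+c)\<^esup> \<delta>\<^sup>2) = O(\<delta> p n\<^sup>s)\<close>. Markov's inequality and a lower tail bound for the
  number of hyperedges finish the proof with \<open>\<epsilon>\<close> of order \<open>\<surd>\<delta>\<close>.
\<close>

text \<open>A hyperedge with at most one vertex in \<open>K\<close> has weight zero; excluding these
  makes \<open>trace_exponent_le\<close> applicable to every member of \<open>F\<close>. The bound
  \<open>2 \<le> card F\<close> is what makes the later count quadratic in \<delta>.\<close>

definition dense_configs :: "nat \<Rightarrow> 'a set \<Rightarrow> 'a set set \<Rightarrow> ('a set \<times> 'a set set) set" where
  "dense_configs k V E =
     {(K, F). K \<subseteq> V \<and> card K = k \<and> F \<subseteq> E \<and> 2 \<le> card F \<and> (\<forall>f\<in>F. 2 \<le> card (f \<inter> K)) \<and>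
        k choose 2 \<le> (\<Sum>f\<in>F. card (f \<inter> K) choose 2)}"

section \<open>The maximum 2-density of a complete graph\<close>

lemma real_choose_two: "real (n choose 2) = real n * (real n - 1) / 2"
proof (cases n)
  case (Suc m)
  have "even (n * (n - 1))" by (cases "even n") auto
  then show ?thesis
    unfolding choose_two using Suc by (simp add: real_of_nat_div algebra_simps)
qed simp

text \<open>A subgraph on j vertices has at most (j choose 2) edges, and (j choose 2) - 1 = (j -
  2)(j + 1)/2. So its density is at most (j + 1)/2, which grows with j and is attained by the whole
  graph at j = k.\<close>

lemma max_2_density_complete_simple_graph:
  assumes "3 \<le> k"
  shows "max_2_density (complete_simple_graph k) = (real k + 1) / 2"
proof -
  let ?D = "{(real (card (hyperedges J)) - 1) / (real (card (verts J)) - 2) | J.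
            subhypergraph J (complete_simple_graph k) \<and> card (verts J) \<ge> 3}"
  have density: "(real (j choose 2) - 1) / (real j - 2) = (real j + 1) / 2" if "3 \<le> j" for j
    using that by (simp add: real_choose_two field_simps)
  have "finite {J. subhypergraph J (complete_simple_graph k) \<and> card (verts J) \<ge> 3}"
    by (rule finite_subset[of _ "Pow {..<k} \<times> Pow (Pow {..<k})"])
      (auto simp: subhypergraph_def complete_simple_graph_def)
  then have "finite ?D"
    by (rule finite_image_set)
  moreover have "d \<le> (real k + 1) / 2" if "d \<in> ?D" for d
  proof -
    from that obtain J where J: "subhypergraph J (complete_simple_graph k)" "card (verts J) \<ge> 3"
      and d: "d = (real (card (hyperedges J)) - 1) / (real (card (verts J)) - 2)"
      by auto
    let ?j = "card (verts J)"
    have V: "verts J \<subseteq> {..<k}" and fin: "finite (verts J)"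
      using J finite_subset[of "verts J" "{..<k}"]
      by (auto simp: subhypergraph_def complete_simple_graph_def)
    have "?j \<le> k"
      using card_mono[OF _ V] by simp
    have "hyperedges J \<subseteq> {e. e \<subseteq> verts J \<and> card e = 2}"
      using J by (auto simp: subhypergraph_def complete_simple_graph_def wf_hypergraph_def)
    then have "card (hyperedges J) \<le> ?j choose 2"
      using n_subsets[OF fin, of 2] card_mono[of "{e. e \<subseteq> verts J \<and> card e = 2}"] fin by auto
    then have "d \<le> (real (?j choose 2) - 1) / (real ?j - 2)"
      unfolding d using J(2) by (intro divide_right_mono) auto
    also have "\<dots> \<le> (real k + 1) / 2"
      using density[OF J(2)] \<open>?j \<le> k\<close> by simp
    finally show ?thesis .
  qed
  moreover have "(real k + 1) / 2 \<in> ?D"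
  proof -
    have "card (hyperedges (complete_simple_graph k)) = k choose 2"
      using n_subsets[of "{..<k}" 2] by (simp add: complete_simple_graph_def)
    moreover have "subhypergraph (complete_simple_graph k) (complete_simple_graph k)"
      by (auto simp: subhypergraph_def wf_hypergraph_def complete_simple_graph_def)
    moreover have "card (verts (complete_simple_graph k)) = k"
      by (simp add: complete_simple_graph_def)
    ultimately show ?thesis
      using density[OF assms] assms by (intro CollectI exI[of _ "complete_simple_graph k"]) auto
  qed
  ultimately show ?thesis
    unfolding max_2_density_def by (intro Max_eqI) auto
qed

section \<open>Deterministic reduction: destroying dense configurations by deletion\<close>

lemma linear_hypergraph_if_no_dense_configs:
  assumes "2 \<le> k" "k \<le> s" "finite V" "\<And>e. e \<in> E \<Longrightarrow> e \<subseteq> V \<and> card e = s"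
    and none: "dense_configs k V E = {}"
  shows "linear_hypergraph (V, E)"
proof -
  have "card (e \<inter> f) \<le> 1" if ef: "e \<in> E" "f \<in> E" "e \<noteq> f" for e f
  proof (rule ccontr)
    assume "\<not> card (e \<inter> f) \<le> 1"
    then have "2 \<le> card (e \<inter> f)" by simp
    then obtain A where A: "A \<subseteq> e \<inter> f" "card A = 2" "finite A"
      by (metis obtain_subset_with_card_n)
    have fin: "finite e" "card e = s" "e \<subseteq> V"
      using assms(3,4) ef finite_subset by blast+
    \<comment> \<open>A \<open>k\<close>-set inside \<open>e\<close> through two common vertices:
      \<open>e\<close> alone supplies the full weight \<open>k choose 2\<close>, and
      \<open>f\<close> is the second hyperedge meeting \<open>K\<close> in two vertices.\<close>
    obtain K where K: "A \<subseteq> K" "K \<subseteq> e" "card K = k"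
      using exists_subset_between[of A k e] A fin assms(1,2) by auto
    have finK: "finite K" using K fin finite_subset by blast
    have "e \<inter> K = K" using K by auto
    have "A \<subseteq> f \<inter> K" using A K by auto
    then have "2 \<le> card (f \<inter> K)" using card_mono[of "f \<inter> K" A] finK A by auto
    then have "(K, {e, f}) \<in> dense_configs k V E"
      unfolding dense_configs_def using K fin ef \<open>e \<inter> K = K\<close> assms(1) by auto
    with none show False by simp
  qed
  moreover have "finite e" if "e \<in> E" for e
    using assms(3,4) that finite_subset by blast
  ultimately show ?thesis
    by (auto simp: linear_hypergraph_def)
qed

text \<open>For a clique \<open>K\<close> inside no hyperedge, take \<open>F\<close> to be all
  hyperedges with at least two vertices in \<open>K\<close>. Their traces cover every pair of
  \<open>K\<close>, so the weights add up to at least \<open>k choose 2\<close>.\<close>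

lemma conformal_if_no_dense_configs:
  assumes "2 \<le> k" "finite V" "\<And>e. e \<in> E \<Longrightarrow> e \<subseteq> V"
    and none: "dense_configs k V E = {}"
  shows "conformal k (V, E)"
  unfolding conformal_def
proof (intro allI impI, rule ccontr)
  fix K assume K: "finite K \<and> card K = k \<and> is_clique (primal_graph (V, E)) K"
    and nc: "\<not> (\<exists>e\<in>hyperedges (V, E). K \<subseteq> e)"
  have "K \<subseteq> V" using K by (simp add: is_clique_def primal_graph_def)
  define F where "F = {f \<in> E. 2 \<le> card (f \<inter> K)}"
  have "E \<subseteq> Pow V" using assms(3) by auto
  then have "finite E" using assms(2) finite_subset by blast
  then have "finite F" by (simp add: F_def)
  have cover: "\<exists>f\<in>F. {u, v} \<subseteq> f" if uv: "u \<in> K" "v \<in> K" "u \<noteq> v" for u v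
  proof -
    obtain f where f: "f \<in> E" "{u, v} \<subseteq> f"
      using K uv unfolding is_clique_def primal_graph_def by simp blast
    have "card {u, v} \<le> card (f \<inter> K)"
      using f uv K by (intro card_mono) auto
    then show ?thesis using f uv by (auto simp: F_def)
  qed
  \<comment> \<open>Two members of \<open>F\<close>: a hyperedge \<open>f\<close> over a pair
    \<open>u\<close>, \<open>v\<close> misses some \<open>w\<close> in \<open>K\<close>, so the
    hyperedge \<open>g\<close> over \<open>u\<close>, \<open>w\<close> is different from
    \<open>f\<close>.\<close>
  have "\<not> card K \<le> 1" using K assms(1) by auto
  then obtain u v where uv: "u \<in> K" "v \<in> K" "u \<noteq> v"
    using K card_le_Suc0_iff_eq[of K] by auto
  obtain f where f: "f \<in> F" "{u, v} \<subseteq> f" using cover[OF uv] by blast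
  have "f \<in> E" using f by (simp add: F_def)
  then obtain w where w: "w \<in> K" "w \<notin> f" using nc by auto
  have "u \<noteq> w" using w f by auto
  obtain g where g: "g \<in> F" "{u, w} \<subseteq> g" using cover[OF uv(1) w(1) \<open>u \<noteq> w\<close>] by blast
  have "card {f, g} \<le> card F"
    using f g \<open>finite F\<close> by (intro card_mono) auto
  moreover have "f \<noteq> g" using g w by auto
  ultimately have "2 \<le> card F" by simp
  let ?P = "\<lambda>A. {e. e \<subseteq> A \<and> card e = 2}"
  have "?P K \<subseteq> (\<Union>f\<in>F. ?P (f \<inter> K))"
  proof
    fix e assume e: "e \<in> ?P K"
    then obtain u v where "e = {u, v}" "u \<noteq> v" by (auto simp: card_2_iff)
    with e cover[of u v] show "e \<in> (\<Union>f\<in>F. ?P (f \<inter> K))" by auto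
  qed
  then have "card (?P K) \<le> card (\<Union>f\<in>F. ?P (f \<inter> K))"
    using K \<open>finite F\<close> by (intro card_mono) auto
  also have "\<dots> \<le> (\<Sum>f\<in>F. card (?P (f \<inter> K)))"
    using \<open>finite F\<close> by (rule card_UN_le)
  also have "\<dots> = (\<Sum>f\<in>F. card (f \<inter> K) choose 2)"
    using K by (intro sum.cong refl n_subsets) auto
  finally have "k choose 2 \<le> (\<Sum>f\<in>F. card (f \<inter> K) choose 2)"
    using K n_subsets[of K 2] by simp
  then have "(K, F) \<in> dense_configs k V E"
    using \<open>K \<subseteq> V\<close> K \<open>2 \<le> card F\<close> by (auto simp: dense_configs_def F_def)
  with none show False by simp
qed

lemma finite_dense_configs:
  assumes "finite V" "finite E"
  shows "finite (dense_configs k V E)"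
  by (rule finite_subset[of _ "Pow V \<times> Pow E"]) (use assms in \<open>auto simp: dense_configs_def\<close>)

lemma delete_dense_configs:
  assumes "2 \<le> k" "k \<le> s" "finite V" "\<And>e. e \<in> E \<Longrightarrow> e \<subseteq> V \<and> card e = s"
  shows "\<exists>H0. subhypergraph H0 (V, E) \<and> linear_hypergraph H0 \<and> conformal k H0 \<and>
           card E \<le> card (hyperedges H0) + card (dense_configs k V E)"
proof -
  have "E \<subseteq> Pow V" using assms(4) by auto
  then have "finite E" using assms(3) finite_subset by blast
  let ?D = "dense_configs k V E"
  have "F \<noteq> {}" if "(K, F) \<in> ?D" for K F
    using that by (auto simp: dense_configs_def)
  then have "\<forall>x\<in>?D. \<exists>f. f \<in> snd x" by fastforce
  then obtain r where "\<forall>x\<in>?D. r x \<in> snd x" by (metis bchoice)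
  then have r: "r (K, F) \<in> F" if "(K, F) \<in> ?D" for K F
    using that by force
  define E0 where "E0 = E - r ` ?D"
  have "card (r ` ?D) \<le> card ?D"
    using finite_dense_configs[OF assms(3) \<open>finite E\<close>] by (rule card_image_le)
  moreover have "card E - card (r ` ?D) \<le> card E0"
    unfolding E0_def using finite_dense_configs[OF assms(3) \<open>finite E\<close>]
    by (intro diff_card_le_card_Diff) auto
  ultimately have "card E \<le> card E0 + card ?D" by simp
  \<comment> \<open>Deletion creates no new configuration, since \<open>E\<close> enters only
    through \<open>F \<subseteq> E\<close>. A surviving one would thus be an old one, and its
    \<open>F\<close> would still contain its deleted hyperedge \<open>r (K, F)\<close>.\<close>
  moreover have "dense_configs k V E0 = {}"
  proof -
    have "(K, F) \<in> ?D \<and> F \<subseteq> E0" if "(K, F) \<in> dense_configs k V E0" for K F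
      using that by (auto simp: dense_configs_def E0_def)
    then show ?thesis using r by (fastforce simp: E0_def)
  qed
  moreover have E0: "e \<subseteq> V \<and> card e = s" if "e \<in> E0" for e
    using that assms(4) by (auto simp: E0_def)
  ultimately show ?thesis
    using linear_hypergraph_if_no_dense_configs[of k s V E0]
      conformal_if_no_dense_configs[of k V E0] assms
    by (intro exI[of _ "(V, E0)"]) (auto simp: subhypergraph_def wf_hypergraph_def E0_def)
qed

section \<open>The weighted count of dense configurations\<close>

lemma card_sets_with_trace_le:
  assumes "finite V" "finite A"
  shows "card {f. f \<subseteq> V \<and> card f = s \<and> f \<inter> K = A} \<le> card V ^ (s - card A)"
proof -
  let ?B = "{f. f \<subseteq> V \<and> card f = s \<and> f \<inter> K = A}"
  \<comment> \<open>Once the trace \<open>A\<close> is fixed, \<open>f\<close> is determined by its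
    \<open>s - card A\<close> remaining vertices.\<close>
  have "inj_on (\<lambda>f. f - A) ?B"
    by (rule inj_onI) blast
  moreover have "(\<lambda>f. f - A) ` ?B \<subseteq> {g. g \<subseteq> V \<and> card g = s - card A}"
    using assms by (auto simp: card_Diff_subset)
  ultimately have "card ?B \<le> card {g. g \<subseteq> V \<and> card g = s - card A}"
    using assms by (intro card_inj_on_le) auto
  also have "\<dots> = card V choose (s - card A)"
    using assms by (simp add: n_subsets)
  also have "\<dots> \<le> card V ^ (s - card A)"
    by (cases "s - card A \<le> card V") (auto simp: binomial_le_pow binomial_eq_0)
  finally show ?thesis .
qed

text \<open>With \<sigma> = \<open>sum x T\<close>, the sum over all subsets factors as the product
  of the 1 + x(f), which is at most exp \<sigma>. The empty set and the singletons account for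
  exactly 1 + \<sigma>, and exp \<sigma> - 1 - \<sigma> <= \<sigma>^2 for 0 <= \<sigma> <=
  1.\<close>

lemma sum_prod_subsets_card_ge_2_le:
  fixes x :: "'a \<Rightarrow> real"
  assumes "finite T" "\<And>f. f \<in> T \<Longrightarrow> 0 \<le> x f" "sum x T \<le> 1"
  shows "(\<Sum>F | F \<subseteq> T \<and> 2 \<le> card F. \<Prod>f\<in>F. x f) \<le> (sum x T)\<^sup>2"
proof -
  let ?L = "{F. F \<subseteq> T \<and> 2 \<le> card F}" and ?S = "insert {} ((\<lambda>f. {f}) ` T)"
  have "Pow T = ?L \<union> ?S"
  proof (intro equalityI subsetI)
    fix F assume F: "F \<in> Pow T"
    then have "finite F" using assms(1) finite_subset by auto
    then have "F = {} \<or> (\<exists>f. F = {f}) \<or> 2 \<le> card F"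
      by (metis One_nat_def Suc_1 card_1_singletonE card_eq_0_iff le_less_Suc_eq less_Suc0 not_le)
    with F show "F \<in> ?L \<union> ?S" by auto
  qed auto
  moreover have "?L \<inter> ?S = {}" by auto
  moreover have "finite ?L" "finite ?S" using assms(1) by auto
  ultimately have "(\<Sum>F\<in>Pow T. prod x F) = (\<Sum>F\<in>?L. prod x F) + (\<Sum>F\<in>?S. prod x F)"
    by (metis (no_types, lifting) sum.union_disjoint)
  also have "(\<Sum>F\<in>?S. prod x F) = 1 + sum x T"
    using assms(1) by (subst sum.insert) (auto simp: sum.reindex inj_on_def)
  finally have "(\<Sum>F\<in>?L. prod x F) = (\<Sum>F\<in>Pow T. prod x F) - 1 - sum x T" by simp
  also have "(\<Sum>F\<in>Pow T. prod x F) = (\<Prod>f\<in>T. x f + 1)"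
    using assms(1) by (simp add: prod_add)
  also have "\<dots> \<le> (\<Prod>f\<in>T. exp (x f))"
    using assms(2) by (intro prod_mono) (auto simp: add.commute)
  also have "\<dots> = exp (sum x T)"
    using assms(1) by (simp add: exp_sum)
  also have "\<dots> \<le> 1 + sum x T + (sum x T)\<^sup>2"
    using assms by (intro exp_bound sum_nonneg) auto
  finally show ?thesis by simp
qed

text \<open>The right side minus the left side equals (a - 2)(k - a)/(k + 1).\<close>

lemma trace_exponent_le:
  assumes "2 \<le> a" "a \<le> k"
  shows "2 / (real k + 1) * real (a choose 2) \<le> real a - 2 + 2 / (real k + 1)"
proof -
  have "0 \<le> (real a - 2) * (real k - real a)"
    using assms by simp
  then have "2 * real (a choose 2) \<le> (real a - 2) * (real k + 1) + 2"
    by (simp add: real_choose_two field_simps)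
  then have "2 * real (a choose 2) / (real k + 1) \<le> ((real a - 2) * (real k + 1) + 2) / (real k + 1)"
    by (rule divide_right_mono) simp
  then show ?thesis
    by (simp add: add_divide_distrib)
qed

text \<open>Group the hyperedges by their trace on \<open>K\<close>. A trace of size a belongs to at
  most n^(s-a) of them, and \<open>trace_exponent_le\<close> bounds the tilt by n^(a-2+c), so a
  cancels and every one of the at most 2^k traces contributes at most p n^(s-2+c).\<close>

lemma sum_tilted_edges_le:
  fixes p c :: real
  assumes V: "finite V" "V \<noteq> {}" and K: "K \<subseteq> V" "card K = k" and "k \<le> s" and "0 \<le> p"
    and c: "c = 2 / (real k + 1)"
  shows "(\<Sum>f | f \<subseteq> V \<and> card f = s \<and> 2 \<le> card (f \<inter> K).
            p * real (card V) powr (c * real (card (f \<inter> K) choose 2)))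
          \<le> 2 ^ k * (p * real (card V) powr (real s - 2 + c))"
proof -
  let ?T = "{f. f \<subseteq> V \<and> card f = s \<and> 2 \<le> card (f \<inter> K)}"
    and ?U = "{A \<in> Pow K. 2 \<le> card A}" and ?n = "real (card V)"
  let ?h = "\<lambda>A. p * ?n powr (c * real (card A choose 2))"
  let ?d = "p * ?n powr (real s - 2 + c)"
  have finK: "finite K" using V K finite_subset by blast
  have n: "1 \<le> ?n" using V by (simp add: Suc_le_eq card_gt_0_iff)
  have "(\<Sum>f\<in>?T. ?h (f \<inter> K)) = (\<Sum>A\<in>?U. \<Sum>f | f \<in> ?T \<and> f \<inter> K = A. ?h (f \<inter> K))"
    using V finK by (intro sum.group[symmetric]) auto
  also have "\<dots> \<le> (\<Sum>A\<in>?U. ?d)"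
  proof (rule sum_mono)
    fix A assume A: "A \<in> ?U"
    let ?B = "{f. f \<subseteq> V \<and> card f = s \<and> f \<inter> K = A}"
    have a: "2 \<le> card A" "card A \<le> k" "finite A"
      using A K finK card_mono[of K A] finite_subset by auto
    have "{f \<in> ?T. f \<inter> K = A} = ?B" using a by auto
    then have "(\<Sum>f | f \<in> ?T \<and> f \<inter> K = A. ?h (f \<inter> K)) = real (card ?B) * ?h A"
      by simp
    also have "\<dots> \<le> ?n ^ (s - card A) * ?h A"
      using card_sets_with_trace_le[OF V(1) a(3), of s K] assms(6)
      by (intro mult_right_mono) (simp_all flip: of_nat_power)
    \<comment> \<open>The truncated subtraction is exact because
      \<open>card A \<le> k \<le> s\<close>.\<close>
    also have "?n ^ (s - card A) = ?n powr (real s - real (card A))"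
      using n a assms(5) by (subst powr_realpow[symmetric]) auto
    also have "?n powr (real s - real (card A)) * ?h A
        = p * ?n powr (real s - real (card A) + c * real (card A choose 2))"
      by (simp add: powr_add)
    also have "\<dots> \<le> ?d"
      using trace_exponent_le[OF a(1,2)] n assms(6) unfolding c
      by (intro mult_left_mono powr_mono) auto
    finally show "(\<Sum>f | f \<in> ?T \<and> f \<inter> K = A. ?h (f \<inter> K)) \<le> ?d" .
  qed
  also have "\<dots> = real (card ?U) * ?d" by simp
  also have "\<dots> \<le> 2 ^ k * ?d"
  proof (rule mult_right_mono)
    have "card ?U \<le> card (Pow K)" using finK by (intro card_mono) auto
    then show "real (card ?U) \<le> 2 ^ k"
      using K finK by (simp add: card_Pow flip: of_nat_le_iff)
  qed (use assms(6) in auto)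
  finally show ?thesis .
qed

text \<open>Each of the at most n^k sets \<open>K\<close> contributes at most n^(-W) (2^k
  \<delta>)^2, where W = c (k choose 2) = k - 2 + c. Since n^(k-W) = n^(2-c), one factor \<delta>
  turns into p n^s and the other remains as the gain.\<close>

lemma sum_dense_configs_le:
  fixes p c \<delta> :: real
  assumes V: "finite V" "V \<noteq> {}" and "k \<le> s" and "0 \<le> p"
    and c: "c = 2 / (real k + 1)" and \<delta>: "\<delta> = p * real (card V) powr (real s - 2 + c)"
    and small: "2 ^ k * \<delta> \<le> 1"
  shows "(\<Sum>(K, F)\<in>dense_configs k V {e. e \<subseteq> V \<and> card e = s}. p ^ card F)
          \<le> 4 ^ k * \<delta> * (p * real (card V) powr real s)"
proof -
  let ?n = "real (card V)" and ?T = "\<lambda>K. {f. f \<subseteq> V \<and> card f = s \<and> 2 \<le> card (f \<inter> K)}"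
  let ?x = "\<lambda>K f. p * ?n powr (c * real (card (f \<inter> K) choose 2))"
  let ?KK = "{K. K \<subseteq> V \<and> card K = k}"
  let ?FF = "\<lambda>K. {F. F \<subseteq> ?T K \<and> 2 \<le> card F \<and> k choose 2 \<le> (\<Sum>f\<in>F. card (f \<inter> K) choose 2)}"
  define W where "W = real k - 2 + c"
  have W: "c * real (k choose 2) = W"
    unfolding W_def c by (simp add: real_choose_two field_simps)
  have n: "1 \<le> ?n" using V by (simp add: Suc_le_eq card_gt_0_iff)
  have "0 \<le> c" using c by simp
  have "0 \<le> \<delta>" using \<delta> assms(4) by simp
  have fin: "finite ?KK" "finite (?T K)" "finite (?FF K)" for K
    using V by (auto intro: finite_subset[of _ "Pow V"] finite_subset[of _ "Pow (Pow V)"])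
  have inner: "(\<Sum>F\<in>?FF K. p ^ card F) \<le> ?n powr - W * (4 ^ k * \<delta>\<^sup>2)" if "K \<in> ?KK" for K
  proof -
    have K: "K \<subseteq> V" "card K = k" using that by auto
    have y: "sum (?x K) (?T K) \<le> 2 ^ k * \<delta>"
      unfolding \<delta> using sum_tilted_edges_le[OF V K assms(3,4) c] .
    have y0: "0 \<le> sum (?x K) (?T K)" using assms(4) by (intro sum_nonneg) auto
    \<comment> \<open>The tilt: the weights of \<open>F\<close> sum to at least
      \<open>k choose 2\<close>, so n^(-W) times the product of the factors n^(c w(f)) is at least 1
      and may be multiplied onto \<open>p ^ card F\<close>.\<close>
    have "p ^ card F \<le> ?n powr - W * prod (?x K) F" if "F \<in> ?FF K" for F
    proof -
      have "W \<le> c * real (\<Sum>f\<in>F. card (f \<inter> K) choose 2)"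
        unfolding W[symmetric] using that \<open>0 \<le> c\<close> by (intro mult_left_mono) (simp_all del: of_nat_sum)
      then have "1 \<le> ?n powr (- W + c * real (\<Sum>f\<in>F. card (f \<inter> K) choose 2))"
        using n by (intro ge_one_powr_ge_zero) auto
      also have "\<dots> = ?n powr - W * (\<Prod>f\<in>F. ?n powr (c * real (card (f \<inter> K) choose 2)))"
        using V by (simp only: powr_add of_nat_sum sum_distrib_left) (simp add: powr_sum)
      finally have "p ^ card F * 1 \<le> p ^ card F * \<dots>"
        using assms(4) by (intro mult_left_mono) auto
      then show ?thesis by (simp add: prod.distrib mult_ac)
    qed
    then have "(\<Sum>F\<in>?FF K. p ^ card F) \<le> (\<Sum>F\<in>?FF K. ?n powr - W * prod (?x K) F)"
      by (intro sum_mono) auto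
    also have "\<dots> = ?n powr - W * (\<Sum>F\<in>?FF K. prod (?x K) F)"
      by (simp add: sum_distrib_left)
    \<comment> \<open>The weight condition has now been paid for by the tilt. Dropping it only adds
      nonnegative terms and leaves a sum over all sets of at least two hyperedges.\<close>
    also have "\<dots> \<le> ?n powr - W * (\<Sum>F | F \<subseteq> ?T K \<and> 2 \<le> card F. prod (?x K) F)"
      using V assms(4) fin
      by (intro mult_left_mono sum_mono2 prod_nonneg) (auto intro: finite_subset[of _ "Pow (Pow V)"])
    also have "\<dots> \<le> ?n powr - W * (sum (?x K) (?T K))\<^sup>2"
      using fin y small assms(4)
      by (intro mult_left_mono sum_prod_subsets_card_ge_2_le) auto
    also have "\<dots> \<le> ?n powr - W * (2 ^ k * \<delta>)\<^sup>2"
      using y y0 by (intro mult_left_mono power_mono) auto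
    also have "(2 ^ k * \<delta>)\<^sup>2 = 4 ^ k * \<delta>\<^sup>2"
      by (simp add: power_mult_distrib flip: power_mult) (simp add: power_mult mult.commute[of k])
    finally show ?thesis .
  qed
  have "dense_configs k V {e. e \<subseteq> V \<and> card e = s} = (SIGMA K:?KK. ?FF K)"
    by (auto simp: dense_configs_def)
  then have "(\<Sum>(K, F)\<in>dense_configs k V {e. e \<subseteq> V \<and> card e = s}. p ^ card F)
      = (\<Sum>K\<in>?KK. \<Sum>F\<in>?FF K. p ^ card F)"
    using fin by (simp add: sum.Sigma)
  also have "\<dots> \<le> (\<Sum>K\<in>?KK. ?n powr - W * (4 ^ k * \<delta>\<^sup>2))"
    using inner by (rule sum_mono)
  also have "\<dots> = real (card ?KK) * (?n powr - W * (4 ^ k * \<delta>\<^sup>2))"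
    by simp
  also have "\<dots> \<le> ?n powr real k * (?n powr - W * (4 ^ k * \<delta>\<^sup>2))"
  proof (rule mult_right_mono)
    \<comment> \<open>The empty trace on the empty set imposes no condition, so the trace bound
      counts all \<open>k\<close>-sets.\<close>
    have "card ?KK \<le> card V ^ k"
      using card_sets_with_trace_le[OF V(1), of "{}" k "{}"] by simp
    then have "real (card ?KK) \<le> ?n ^ k"
      by (simp flip: of_nat_power)
    then show "real (card ?KK) \<le> ?n powr real k"
      using n by (simp add: powr_realpow)
  qed simp
  also have "\<dots> = 4 ^ k * \<delta> * (\<delta> * ?n powr (real k - W))"
    by (simp add: powr_diff powr_minus power2_eq_square field_simps)
  also have "\<delta> * ?n powr (real k - W) = p * ?n powr real s"
    unfolding \<delta> W_def by (simp flip: powr_add)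
  finally show ?thesis .
qed

section \<open>Probability estimates for independently chosen hyperedges\<close>

lemma prob_Pi_bernoulli_all:
  assumes "finite S" "F \<subseteq> S" "0 \<le> p" "p \<le> 1"
  shows "measure_pmf.prob (Pi_pmf S dflt (\<lambda>_. bernoulli_pmf p)) {X. \<forall>f\<in>F. X f} = p ^ card F"
proof -
  have "{X. \<forall>f\<in>F. X f} = Pi S (\<lambda>f. if f \<in> F then {True} else UNIV)"
    using assms(2) by (auto simp: Pi_def)
  then have "measure_pmf.prob (Pi_pmf S dflt (\<lambda>_. bernoulli_pmf p)) {X. \<forall>f\<in>F. X f}
      = (\<Prod>f\<in>S. measure_pmf.prob (bernoulli_pmf p) (if f \<in> F then {True} else UNIV))"
    using assms(1) by (simp add: measure_Pi_pmf_Pi)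
  also have "\<dots> = (\<Prod>f\<in>S. if f \<in> F then p else 1)"
    using assms(3,4) by (intro prod.cong) (auto simp: measure_pmf_single)
  also have "\<dots> = p ^ card F"
    using assms(1,2) by (simp add: prod.If_cases Int_absorb1)
  finally show ?thesis .
qed

lemma expectation_card_dense_configs:
  assumes "finite V" "finite S" "0 \<le> p" "p \<le> 1"
  shows "measure_pmf.expectation (Pi_pmf S dflt (\<lambda>_. bernoulli_pmf p))
           (\<lambda>X. real (card (dense_configs k V {e\<in>S. X e})))
         = (\<Sum>(K, F)\<in>dense_configs k V S. p ^ card F)"
proof -
  let ?D = "dense_configs k V S" and ?M = "Pi_pmf S dflt (\<lambda>_. bernoulli_pmf p)"
  have fin: "finite ?D" using assms by (intro finite_dense_configs)
  have eq: "real (card (dense_configs k V {e\<in>S. X e}))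
      = (\<Sum>x\<in>?D. indicator {X. \<forall>f\<in>snd x. X f} X)" for X
  proof -
    \<comment> \<open>The random configurations are those of the full set \<open>S\<close> whose
      hyperedges are all present, so the count is a sum of indicators over a fixed finite set and
      linearity of expectation applies.\<close>
    have "dense_configs k V {e\<in>S. X e} = {x \<in> ?D. X \<in> {X. \<forall>f\<in>snd x. X f}}"
      by (auto simp: dense_configs_def)
    then show ?thesis
      using fin by (simp add: indicator_def sum.If_cases Int_def)
  qed
  have "measure_pmf.expectation ?M (\<lambda>X. real (card (dense_configs k V {e\<in>S. X e})))
      = (\<Sum>x\<in>?D. measure_pmf.prob ?M {X. \<forall>f\<in>snd x. X f})"
    unfolding eq
    by (subst Bochner_Integration.integral_sum)
      (auto simp: measure_pmf.emeasure_eq_measure)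
  also have "\<dots> = (\<Sum>x\<in>?D. p ^ card (snd x))"
    using assms by (intro sum.cong refl prob_Pi_bernoulli_all) (auto simp: dense_configs_def)
  finally show ?thesis by (simp add: split_beta)
qed

text \<open>An exponential moment bound. Let N be the number of chosen elements and \<mu> its mean.
  Independence gives E[2^(-N)] = (1 - p/2)^|S| <= exp(-\<mu>/2). If N <= \<mu>/4, then 2^(-N) >=
  exp(-N) >= exp(-\<mu>/4), and Markov's inequality gives the quotient of the two bounds.\<close>

lemma prob_card_Pi_bernoulli_le_quarter:
  assumes "finite S" "0 \<le> p" "p \<le> 1"
  shows "measure_pmf.prob (Pi_pmf S dflt (\<lambda>_. bernoulli_pmf p))
           {X. real (card {e\<in>S. X e}) \<le> p * real (card S) / 4} \<le> exp (- (p * real (card S) / 4))"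
proof -
  let ?M = "Pi_pmf S dflt (\<lambda>_. bernoulli_pmf p)" and ?\<mu> = "p * real (card S)"
  let ?u = "\<lambda>X. \<Prod>e\<in>S. if X e then 1 / 2 else (1 :: real)"
  have u: "?u X = (1 / 2) ^ card {e\<in>S. X e}" for X
    using assms(1) by (simp add: prod.If_cases Int_def power_one_over)
  have "measure_pmf.expectation ?M ?u
      = (\<Prod>e\<in>S. measure_pmf.expectation (bernoulli_pmf p) (\<lambda>v. if v then 1 / 2 else 1))"
    using assms(1)
    by (intro expectation_prod_Pi_pmf[where f = "\<lambda>_ v. if v then 1 / 2 else 1"])
      (auto intro: integrable_measure_pmf_finite)
  also have "\<dots> = (1 - p / 2) ^ card S"
    using assms(2,3) by (simp add: field_simps)
  also have "\<dots> \<le> exp (- (p / 2)) ^ card S"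
    using assms(3) exp_ge_add_one_self[of "- (p / 2)"] by (intro power_mono) auto
  also have "\<dots> = exp (- (?\<mu> / 2))"
    by (simp add: mult_ac flip: exp_of_nat_mult)
  finally have E: "measure_pmf.expectation ?M ?u \<le> exp (- (?\<mu> / 2))" .
  have "exp (- (?\<mu> / 4)) \<le> ?u X" if "real (card {e\<in>S. X e}) \<le> ?\<mu> / 4" for X
  proof -
    have "exp (- (?\<mu> / 4)) \<le> exp (- real (card {e\<in>S. X e}))"
      using that by simp
    also have "\<dots> = exp (- 1) ^ card {e\<in>S. X e}"
      by (simp flip: exp_of_nat_mult)
    also have "\<dots> \<le> (1 / 2) ^ card {e\<in>S. X e}"
      using exp_ge_add_one_self[of 1] by (intro power_mono) (auto simp: exp_minus field_simps)
    finally show ?thesis using u by simp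
  qed
  then have "measure_pmf.prob ?M {X. real (card {e\<in>S. X e}) \<le> ?\<mu> / 4}
      \<le> measure_pmf.prob ?M {X. exp (- (?\<mu> / 4)) \<le> ?u X}"
    by (intro measure_pmf.finite_measure_mono) auto
  also have "\<dots> \<le> measure_pmf.expectation ?M ?u / exp (- (?\<mu> / 4))"
  proof -
    have "integrable (measure_pmf ?M) ?u"
      by (rule measure_pmf.integrable_const_bound[where B = 1])
        (auto simp: u power_le_one)
    then show ?thesis
      using integral_Markov_inequality_measure[of "measure_pmf ?M" ?u "{}" "exp (- (?\<mu> / 4))"]
      by (simp add: u)
  qed
  also have "\<dots> \<le> exp (- (?\<mu> / 2)) / exp (- (?\<mu> / 4))"
    using E by (intro divide_right_mono) auto
  also have "\<dots> = exp (- (?\<mu> / 4))"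
    by (simp flip: exp_diff)
  finally show ?thesis .
qed

section \<open>The quantitative statement for fixed n, and the passage to the limit\<close>

lemma prob_near_linear_conformal:
  fixes p c \<delta> :: real
  assumes "3 \<le> k" "k \<le> s" "s \<le> n" "0 < p" "p \<le> 1"
    and c: "c = 2 / (real k + 1)" and \<delta>: "\<delta> = p * real n powr (real s - 2 + c)"
    and small: "2 ^ k * \<delta> \<le> 1"
  shows "1 - (4 ^ k * sqrt \<delta> + exp (- (p * real n powr real s / (4 * real s ^ s))))
    \<le> measure_pmf.prob (random_hypergraph s n p)
       {H. \<exists>H0. subhypergraph H0 H \<and> linear_hypergraph H0 \<and> conformal k H0 \<and>
          real (card (hyperedges H0)) \<ge> (1 - 4 * real s ^ s * sqrt \<delta>) * real (card (hyperedges H))}"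
    (is "_ \<le> measure_pmf.prob _ ?G")
proof -
  define S where "S = {e. e \<subseteq> {..<n} \<and> card e = s}"
  define M where "M = Pi_pmf S False (\<lambda>_. bernoulli_pmf p)"
  let ?E = "\<lambda>X. {e\<in>S. X e}" and ?D = "\<lambda>X. dense_configs k {..<n} {e\<in>S. X e}"
  let ?q = "p * real n powr real s"
  have finS: "finite S" unfolding S_def by simp
  have n: "0 < n" and s: "0 < s" using assms by auto
  have "0 < \<delta>" "0 < ?q" using assms(4) n unfolding \<delta> by auto
  \<comment> \<open>From (n/s)^s <= (n choose s): the mean number of hyperedges is at least p n^s /
    s^s, which is the source of the constant \<open>real s ^ s\<close>.\<close>
  have \<mu>: "?q / real s ^ s \<le> p * real (card S)"
  proof -
    have "(real n / real s) ^ s \<le> real (card S)"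
      using binomial_ge_n_over_k_pow_k[OF assms(3), where 'a = real]
      by (simp add: S_def n_subsets)
    then have "p * (real n / real s) ^ s \<le> p * real (card S)"
      using assms(4) by (intro mult_left_mono) auto
    then show ?thesis using n by (simp add: power_divide powr_realpow)
  qed
  \<comment> \<open>The threshold \<open>sqrt \<delta> * ?q\<close> balances two demands: as the
    mean is at most \<open>4 ^ k * \<delta> * ?q\<close>, Markov's inequality bounds the probability
    of \<open>A\<close> by \<open>4 ^ k * sqrt \<delta>\<close>, while fewer than
    \<open>sqrt \<delta> * ?q\<close> deletions are a small loss compared with p n^s.\<close>
  define A where "A = {X. sqrt \<delta> * ?q \<le> real (card (?D X))}"
  define B where "B = {X. real (card (?E X)) \<le> p * real (card S) / 4}"
  have "measure_pmf.prob M A \<le> measure_pmf.expectation M (\<lambda>X. real (card (?D X))) / (sqrt \<delta> * ?q)"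
  proof -
    have "integrable (measure_pmf M) (\<lambda>X. real (card (?D X)))"
    proof (rule measure_pmf.integrable_const_bound)
      have "card (?D X) \<le> card (dense_configs k {..<n} S)" for X
        using finS by (intro card_mono finite_dense_configs) (auto simp: dense_configs_def)
      then show "AE X in M. norm (real (card (?D X))) \<le> real (card (dense_configs k {..<n} S))"
        by simp
    qed simp
    then show ?thesis
      using integral_Markov_inequality_measure[of "measure_pmf M" "\<lambda>X. real (card (?D X))" "{}"
          "sqrt \<delta> * ?q"] \<open>0 < \<delta>\<close> \<open>0 < ?q\<close> by (simp add: A_def)
  qed
  also have "\<dots> = (\<Sum>(K, F)\<in>dense_configs k {..<n} S. p ^ card F) / (sqrt \<delta> * ?q)"
    unfolding M_def using assms finS by (subst expectation_card_dense_configs) auto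
  also have "\<dots> \<le> (4 ^ k * \<delta> * ?q) / (sqrt \<delta> * ?q)"
    using sum_dense_configs_le[of "{..<n}" k s p c \<delta>] assms n \<open>0 < \<delta>\<close> \<open>0 < ?q\<close> c \<delta>
    by (intro divide_right_mono) (auto simp: S_def lessThan_empty_iff)
  also have "\<dots> = 4 ^ k * (\<delta> / sqrt \<delta>)"
    using \<open>0 < ?q\<close>
    by (simp only: times_divide_eq_right mult_divide_mult_cancel_right less_imp_neq[symmetric]
        not_False_eq_True)
  also have "\<dots> = 4 ^ k * sqrt \<delta>"
    using \<open>0 < \<delta>\<close> by (simp add: real_div_sqrt)
  finally have A: "measure_pmf.prob M A \<le> 4 ^ k * sqrt \<delta>" .
  have "measure_pmf.prob M B \<le> exp (- (p * real (card S) / 4))"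
    unfolding M_def B_def using finS assms by (intro prob_card_Pi_bernoulli_le_quarter) auto
  also have "\<dots> \<le> exp (- (?q / (4 * real s ^ s)))"
    using \<mu> by (simp add: field_simps)
  finally have B: "measure_pmf.prob M B \<le> exp (- (?q / (4 * real s ^ s)))" .
  have good: "({..<n}, ?E X) \<in> ?G" if "X \<notin> A" "X \<notin> B" for X
  proof -
    obtain H0 where H0: "subhypergraph H0 ({..<n}, ?E X)" "linear_hypergraph H0" "conformal k H0"
      "card (?E X) \<le> card (hyperedges H0) + card (?D X)"
      using delete_dense_configs[of k s "{..<n}" "?E X"] assms by (auto simp: S_def)
    have "real (card (?D X)) \<le> sqrt \<delta> * ?q"
      using that by (simp add: A_def)
    \<comment> \<open>Outside \<open>B\<close> the quantity p n^s is at most 4 s^s times the actual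
      number of hyperedges, so the loss becomes a fraction
      \<open>4 * real s ^ s * sqrt \<delta>\<close> of them.\<close>
    also have "\<dots> \<le> sqrt \<delta> * (real s ^ s * (4 * real (card (?E X))))"
    proof (rule mult_left_mono)
      have "?q / real s ^ s \<le> 4 * real (card (?E X))"
        using \<mu> that by (simp add: B_def)
      then show "?q \<le> real s ^ s * (4 * real (card (?E X)))"
        using s by (simp add: pos_divide_le_eq mult.commute)
    qed (use \<open>0 < \<delta>\<close> in simp)
    finally have "(1 - 4 * real s ^ s * sqrt \<delta>) * real (card (?E X)) \<le> real (card (hyperedges H0))"
      using H0(4) by (simp add: algebra_simps)
    with H0 show ?thesis by (intro CollectI exI[of _ H0]) auto
  qed
  have "1 - measure_pmf.prob M (A \<union> B) = measure_pmf.prob M (- (A \<union> B))"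
    using measure_pmf.prob_compl[of "A \<union> B" M] by (simp add: Compl_eq_Diff_UNIV)
  also have "\<dots> \<le> measure_pmf.prob M ((\<lambda>X. ({..<n}, ?E X)) -` ?G)"
    using good by (intro measure_pmf.finite_measure_mono) auto
  also have "\<dots> = measure_pmf.prob (random_hypergraph s n p) ?G"
    by (simp add: random_hypergraph_def S_def M_def Let_def)
  finally have "1 - measure_pmf.prob M (A \<union> B) \<le> measure_pmf.prob (random_hypergraph s n p) ?G" .
  moreover have "measure_pmf.prob M (A \<union> B) \<le> measure_pmf.prob M A + measure_pmf.prob M B"
    by (intro measure_Un_le) auto
  ultimately show ?thesis using A B by linarith
qed

theorem theorem3p1:
  fixes s k :: nat and p :: "nat \<Rightarrow> real"
  assumes "3 \<le> k" and "k \<le> s"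
    and "\<And>n. 0 \<le> p n \<and> p n \<le> 1"
    and "filterlim (\<lambda>n. p n * real n powr real s) at_top sequentially"
    and "(\<lambda>n. p n * real n powr (real s - 2 + 1 / max_2_density (complete_simple_graph k)))
           \<longlonglongrightarrow> 0"
  shows "\<exists>\<epsilon> :: nat \<Rightarrow> real. \<epsilon> \<longlonglongrightarrow> 0 \<and>
    (\<lambda>n. measure_pmf.prob (random_hypergraph s n (p n))
       {H. \<exists>H0. subhypergraph H0 H \<and> linear_hypergraph H0 \<and> conformal k H0 \<and>
          real (card (hyperedges H0)) \<ge> (1 - \<epsilon> n) * real (card (hyperedges H))})
      \<longlonglongrightarrow> 1"
proof -
  \<comment> \<open>This is the reciprocal of the maximum 2-density of the complete graph on
    \<open>k\<close> vertices, so \<delta> below is the sequence that tends to 0 by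
    assumption.\<close>
  define c where "c = 2 / (real k + 1)"
  define \<delta> where "\<delta> = (\<lambda>n. p n * real n powr (real s - 2 + c))"
  define q where "q = (\<lambda>n. p n * real n powr real s)"
  define \<epsilon> where "\<epsilon> = (\<lambda>n. 4 * real s ^ s * sqrt (\<delta> n))"
  let ?P = "\<lambda>n. measure_pmf.prob (random_hypergraph s n (p n))
       {H. \<exists>H0. subhypergraph H0 H \<and> linear_hypergraph H0 \<and> conformal k H0 \<and>
          real (card (hyperedges H0)) \<ge> (1 - \<epsilon> n) * real (card (hyperedges H))}"
  have \<delta>: "\<delta> \<longlonglongrightarrow> 0"
    using assms(5) max_2_density_complete_simple_graph[OF assms(1)]
    by (simp add: \<delta>_def c_def)
  then have sqrt: "(\<lambda>n. sqrt (\<delta> n)) \<longlonglongrightarrow> 0"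
    using tendsto_real_sqrt by fastforce
  have q: "filterlim q at_top sequentially"
    using assms(4) by (simp add: q_def)
  \<comment> \<open>The lower bound on p enters here: p n^s tends to infinity, so the probability of
    having too few hyperedges vanishes.\<close>
  have "filterlim (\<lambda>n. 1 / (4 * real s ^ s) * q n) at_top sequentially"
    using assms(1,2) by (intro filterlim_tendsto_pos_mult_at_top[OF tendsto_const _ q]) auto
  then have "filterlim (\<lambda>n. q n / (4 * real s ^ s)) at_top sequentially"
    by simp
  then have "(\<lambda>n. exp (- (q n / (4 * real s ^ s)))) \<longlonglongrightarrow> 0"
    by (intro filterlim_compose[OF exp_at_bot] filterlim_compose[OF filterlim_uminus_at_bot_at_top])
  then have "(\<lambda>n. 1 - (4 ^ k * sqrt (\<delta> n) + exp (- (q n / (4 * real s ^ s)))))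
      \<longlonglongrightarrow> 1 - (4 ^ k * 0 + 0)"
    using sqrt by (intro tendsto_intros)
  moreover have "\<forall>\<^sub>F n in sequentially.
      1 - (4 ^ k * sqrt (\<delta> n) + exp (- (q n / (4 * real s ^ s)))) \<le> ?P n"
  proof -
    have "\<forall>\<^sub>F n in sequentially. \<delta> n < 1 / 2 ^ k"
      using \<delta> by (rule order_tendstoD) simp
    \<comment> \<open>Positivity of \<open>q n\<close> forces \<open>p n > 0\<close>, as required by
      the fixed-n bound, where Markov's inequality needs a positive threshold.\<close>
    moreover have "\<forall>\<^sub>F n in sequentially. 0 < q n"
      using q by (simp add: filterlim_at_top_dense)
    ultimately show ?thesis
      using eventually_ge_at_top[of s]
    proof eventually_elim
      case (elim n)
      have "p n \<noteq> 0" using elim(2) by (auto simp: q_def)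
      then have "0 < p n" using assms(3)[of n] by simp
      moreover have "2 ^ k * \<delta> n \<le> 1" using elim(1) by (simp add: field_simps)
      ultimately show ?case
        using prob_near_linear_conformal[of k s n "p n" c "\<delta> n"] assms(1-3) elim(3)
        by (simp add: c_def \<delta>_def \<epsilon>_def q_def)
    qed
  qed
  ultimately have "?P \<longlonglongrightarrow> 1"
    by (intro tendsto_sandwich[where h = "\<lambda>_. 1" and g = ?P]) auto
  moreover have "\<epsilon> \<longlonglongrightarrow> 0"
    unfolding \<epsilon>_def using tendsto_mult_left[OF sqrt, of "4 * real s ^ s"] by simp
  ultimately show ?thesis by blast
qed

end
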